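(* The field of oracles, with the addition and multiplication induced from rational interval arithmetic and the order $<$ on oracles, is an ordered field.
   Context: For rationals $a,b$, $a:b$ denotes the set of rationals between $a$ and $b$ inclusive, regardless of order (so $a:b=b:a$; $a=b$ is allowed, and $a:a$ is called a singleton). These sets are called rational intervals. A rule is a function $R$ from rational intervals to $\{0,1\}$; an interval is $R$-Yes if $R(a:b)=1$ and $R$-No if $R(a:b)=0$. An oracle is a rule $R$ such that (all letters $a,b,c,d$ rational): (1) Consistency: if $c:d$ contains $a:b$ and $R(a:b)=1$, then $R(c:d)=1$. (2) Existence: $R(a:b)=1$ for some $a:b$. (3) Separating: if $R(a:b)=1$ and $c\in a:b$ with $c\neq a,b$, then $R(c:c)=1$ or $R(a:c)\neq R(c:b)$. (4) Rooted: there is at most one $c$ with $R(c:c)=1$. (5) Closed: if $c$ is contained in all $R$-Yes intervals, then $R(c:c)=1$. Two oracles are equal iff they agree on all rational intervals. Order: $R<S$ iff there are an $R$-Yes interval $a:b$ and an $S$-Yes interval $c:d$ such that both $a$ and $b$ are less than both $c$ and $d$. Interval arithmetic, for $a\le b$ and $c\le d$: $a:b\oplus c:d=(a+c):(b+d)$ and $a:b\otimes c:d=\min(ac,ad,bc,bd):\max(ac,ad,bc,bd)$. A fonsi is a set of pairwise intersecting rational intervals that contains, for every rational $q>0$, an interval of length less than $q$. For each fonsi there is a unique oracle for which all elements of the fonsi are Yes intervals (the associated oracle). For oracles $\alpha,\beta$, the families $\{A\oplus B\}$ and $\{A\otimes B\}$, with $A$ ranging over $\alpha$-Yes intervals and $B$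 over $\beta$-Yes intervals, are fonsis; $\alpha+\beta$ and $\alpha*\beta$ are defined to be the respective associated oracles. *)

theory Defs
  imports Complex_Main
begin

(* A rational interval is identified with its set of points, so a singleton c:c is
   the set {c}, and a:b = b:a. *)
typedef rat_interval = "{I :: rat set. \<exists>a b. I = {min a b..max a b}}"
  morphisms points Abs_rat_interval
  by blast

(* ivl a b is the interval a:b; a and b may come in either order. *)
definition ivl :: "rat \<Rightarrow> rat \<Rightarrow> rat_interval" where
  "ivl a b = Abs_rat_interval {min a b..max a b}"

definition lower :: "rat_interval \<Rightarrow> rat" where
  "lower A = (LEAST x. x \<in> points A)"

definition upper :: "rat_interval \<Rightarrow> rat" where
  "upper A = (GREATEST x. x \<in> points A)"

definition ivl_length :: "rat_interval \<Rightarrow> rat" where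
  "ivl_length A = upper A - lower A"

definition ivl_add :: "rat_interval \<Rightarrow> rat_interval \<Rightarrow> rat_interval" (infixl "\<oplus>" 65) where
  "A \<oplus> B = ivl (lower A + lower B) (upper A + upper B)"

definition ivl_mult :: "rat_interval \<Rightarrow> rat_interval \<Rightarrow> rat_interval" (infixl "\<otimes>" 70) where
  "A \<otimes> B =
     (let P = {lower A * lower B, lower A * upper B, upper A * lower B, upper A * upper B}
      in ivl (Min P) (Max P))"

(* Truth values play the role of 0 and 1: R A means that A is R-Yes. *)
type_synonym rule = "rat_interval \<Rightarrow> bool"

definition consistent_rule :: "rule \<Rightarrow> bool" where
  "consistent_rule R \<longleftrightarrow>
     (\<forall>a b c d. points (ivl a b) \<subseteq> points (ivl c d) \<longrightarrow> R (ivl a b) \<longrightarrow> R (ivl c d))"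

definition existent_rule :: "rule \<Rightarrow> bool" where
  "existent_rule R \<longleftrightarrow> (\<exists>a b. R (ivl a b))"

definition separating_rule :: "rule \<Rightarrow> bool" where
  "separating_rule R \<longleftrightarrow>
     (\<forall>a b c. R (ivl a b) \<longrightarrow> c \<in> points (ivl a b) \<longrightarrow> c \<noteq> a \<longrightarrow> c \<noteq> b \<longrightarrow>
        R (ivl c c) \<or> R (ivl a c) \<noteq> R (ivl c b))"

definition rooted_rule :: "rule \<Rightarrow> bool" where
  "rooted_rule R \<longleftrightarrow> (\<forall>c d. R (ivl c c) \<longrightarrow> R (ivl d d) \<longrightarrow> c = d)"

definition closed_rule :: "rule \<Rightarrow> bool" where
  "closed_rule R \<longleftrightarrow>
     (\<forall>c. (\<forall>a b. R (ivl a b) \<longrightarrow> c \<in> points (ivl a b)) \<longrightarrow> R (ivl c c))"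

definition oracle_rule :: "rule \<Rightarrow> bool" where
  "oracle_rule R \<longleftrightarrow> consistent_rule R \<and> existent_rule R \<and> separating_rule R
     \<and> rooted_rule R \<and> closed_rule R"

lemma points_ivl: "points (ivl a b) = {min a b..max a b}"
  unfolding ivl_def by (rule Abs_rat_interval_inverse) blast

lemma oracle_rule_point: "oracle_rule (\<lambda>A. q \<in> points A)"
proof -
  have "separating_rule (\<lambda>A. q \<in> points A)"
    unfolding separating_rule_def points_ivl by (auto simp: min_def max_def split: if_splits)
  moreover have "q \<in> points (ivl q q)"
    by (simp add: points_ivl)
  moreover have "closed_rule (\<lambda>A. q \<in> points A)"
    unfolding closed_rule_def
  proof (intro allI impI)
    fix c
    assume "\<forall>a b. q \<in> points (ivl a b) \<longrightarrow> c \<in> points (ivl a b)"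
    then have "c \<in> points (ivl q q)"
      using \<open>q \<in> points (ivl q q)\<close> by blast
    then show "q \<in> points (ivl c c)"
      by (simp add: points_ivl)
  qed
  moreover have "rooted_rule (\<lambda>A. q \<in> points A)"
    by (auto simp: rooted_rule_def points_ivl)
  ultimately show ?thesis
    unfolding oracle_rule_def consistent_rule_def existent_rule_def by blast
qed

typedef rat_oracle = "{R :: rule. oracle_rule R}"
  morphisms yes Abs_rat_oracle
  using oracle_rule_point by blast

(* The oracle whose Yes intervals are those containing the rational q; it is the only
   oracle with the singleton q:q as a Yes interval. *)
definition oracle_of_rat :: "rat \<Rightarrow> rat_oracle" where
  "oracle_of_rat q = Abs_rat_oracle (\<lambda>A. q \<in> points A)"

definition fonsi :: "rat_interval set \<Rightarrow> bool" where
  "fonsi F \<longleftrightarrow> (\<forall>A\<in>F. \<forall>B\<in>F. points A \<inter> points B \<noteq> {}) \<and>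
     (\<forall>q>0. \<exists>A\<in>F. ivl_length A < q)"

definition associated_oracle :: "rat_interval set \<Rightarrow> rat_oracle" where
  "associated_oracle F = (THE \<gamma>. fonsi F \<and> (\<forall>A\<in>F. yes \<gamma> A))"

(* Only zero, one, plus, times and the order carry data. The remaining operations demanded by
   the type class linordered_field are determined by these: uminus and inverse are specified
   as the additive and multiplicative inverse, and the others are derived from them. That the
   specified inverses exist is part of what membership in the class asserts. *)
instantiation rat_oracle :: "{zero, one, plus, times, ord, uminus, minus, inverse, abs, sgn}"
begin

definition zero_rat_oracle :: rat_oracle where
  "0 = oracle_of_rat 0"

definition one_rat_oracle :: rat_oracle where
  "1 = oracle_of_rat 1"

definition plus_rat_oracle :: "rat_oracle \<Rightarrow> rat_oracle \<Rightarrow> rat_oracle" where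
  "\<alpha> + \<beta> = associated_oracle {A \<oplus> B |A B. yes \<alpha> A \<and> yes \<beta> B}"

definition times_rat_oracle :: "rat_oracle \<Rightarrow> rat_oracle \<Rightarrow> rat_oracle" where
  "\<alpha> * \<beta> = associated_oracle {A \<otimes> B |A B. yes \<alpha> A \<and> yes \<beta> B}"

definition less_rat_oracle :: "rat_oracle \<Rightarrow> rat_oracle \<Rightarrow> bool" where
  "\<alpha> < \<beta> \<longleftrightarrow> (\<exists>a b c d. yes \<alpha> (ivl a b) \<and> yes \<beta> (ivl c d) \<and> a < c \<and> a < d \<and> b < c \<and> b < d)"

definition less_eq_rat_oracle :: "rat_oracle \<Rightarrow> rat_oracle \<Rightarrow> bool" where
  "\<alpha> \<le> \<beta> \<longleftrightarrow> \<alpha> < \<beta> \<or> \<alpha> = (\<beta> :: rat_oracle)"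

definition uminus_rat_oracle :: "rat_oracle \<Rightarrow> rat_oracle" where
  "- \<alpha> = (THE \<beta> :: rat_oracle. \<alpha> + \<beta> = 0)"

definition minus_rat_oracle :: "rat_oracle \<Rightarrow> rat_oracle \<Rightarrow> rat_oracle" where
  "\<alpha> - \<beta> = \<alpha> + - (\<beta> :: rat_oracle)"

(* Isabelle's fields are totalised by inverse 0 = 0. *)
definition inverse_rat_oracle :: "rat_oracle \<Rightarrow> rat_oracle" where
  "inverse \<alpha> = (if \<alpha> = 0 then 0 else (THE \<beta> :: rat_oracle. \<alpha> * \<beta> = 1))"

definition divide_rat_oracle :: "rat_oracle \<Rightarrow> rat_oracle \<Rightarrow> rat_oracle" where
  "\<alpha> div \<beta> = \<alpha> * inverse (\<beta> :: rat_oracle)"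

definition abs_rat_oracle :: "rat_oracle \<Rightarrow> rat_oracle" where
  "\<bar>\<alpha>\<bar> = (if \<alpha> < 0 then - \<alpha> else (\<alpha> :: rat_oracle))"

definition sgn_rat_oracle :: "rat_oracle \<Rightarrow> rat_oracle" where
  "sgn \<alpha> = (if \<alpha> = 0 then 0 else if 0 < \<alpha> then 1 else - (1 :: rat_oracle))"

instance ..

end

end

theory Submission
  imports Defs
begin

text \<open>
  The Yes intervals of an oracle have exactly one common point when they are read as real
  intervals, and conversely an interval that contains this point is a Yes interval. So oracles
  correspond bijectively to real numbers. Interval arithmetic encloses real arithmetic, and the
  enclosures shrink to the exact result, so the bijection respects sums and products. It also
  respects the order, and the ordered field axioms are therefore inherited from the reals.
\<close>

section \<open>Rational intervals read as real intervals\<close>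

text \<open>Keeps the endpoints but restores the irrational points: the Yes intervals of an oracle
  may have no rational point in common, but they always have a real one.\<close>

definition real_ivl :: "rat_interval \<Rightarrow> real set" where
  "real_ivl A = {of_rat (lower A)..of_rat (upper A)}"

lemma lower_ivl: "lower (ivl a b) = min a b"
  unfolding lower_def points_ivl by (rule Least_equality) auto

lemma upper_ivl: "upper (ivl a b) = max a b"
  unfolding upper_def points_ivl by (rule Greatest_equality) auto

lemma ivl_cases:
  obtains a b where "a \<le> b" "A = ivl a b"
proof -
  obtain a b where "points A = {min a b..max a b}"
    using points[of A] by blast
  then have "A = ivl (min a b) (max a b)"
    by (simp add: points_inject[symmetric] points_ivl)
  then show thesis
    using that[of "min a b" "max a b"] by simp
qed

lemma lower_le_upper: "lower A \<le> upper A"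
  by (cases A rule: ivl_cases) (simp add: lower_ivl upper_ivl)

lemma ivl_lower_upper: "ivl (lower A) (upper A) = A"
  by (cases A rule: ivl_cases) (simp add: lower_ivl upper_ivl)

lemma real_ivl_ivl: "a \<le> b \<Longrightarrow> real_ivl (ivl a b) = {of_rat a..of_rat b}"
  by (simp add: real_ivl_def lower_ivl upper_ivl)

lemma real_ivl_singleton: "real_ivl (ivl c c) = {of_rat c}"
  by (simp add: real_ivl_ivl)

lemma real_ivl_mono: "points A \<subseteq> points B \<Longrightarrow> real_ivl A \<subseteq> real_ivl B"
  by (cases A rule: ivl_cases; cases B rule: ivl_cases)
    (auto simp: real_ivl_ivl points_ivl of_rat_less_eq intro: order_trans)

lemma of_rat_mem_real_ivl_iff: "of_rat c \<in> real_ivl A \<longleftrightarrow> c \<in> points A"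
  by (cases A rule: ivl_cases) (auto simp: real_ivl_ivl points_ivl of_rat_less_eq)

text \<open>Density of the rationals on each side of \<open>r\<close>. This is the source of all
  small Yes intervals below.\<close>

lemma ex_tight_ivl:
  fixes r :: real
  assumes "\<epsilon> > 0"
  obtains a b where "a \<le> b" "r - \<epsilon> < of_rat a" "of_rat a < r" "r < of_rat b" "of_rat b < r + \<epsilon>"
proof -
  obtain a where a: "r - \<epsilon> < of_rat a" "of_rat a < r"
    using of_rat_dense[of "r - \<epsilon>" r] assms by auto
  obtain b where b: "r < of_rat b" "of_rat b < r + \<epsilon>"
    using of_rat_dense[of r "r + \<epsilon>"] assms by auto
  have "(of_rat a :: real) < of_rat b"
    using a b by linarith
  then have "a \<le> b"
    by (simp add: of_rat_less)
  with a b show thesis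
    using that by blast
qed

text \<open>If the points differ, a rational interval around \<open>r\<close> of radius at most
  their distance leaves \<open>s\<close> out.\<close>

lemma real_ivls_determine_point:
  assumes "\<And>A. r \<in> real_ivl A \<Longrightarrow> s \<in> real_ivl A"
  shows "r = s"
proof (rule ccontr)
  assume "r \<noteq> s"
  then obtain a b where "a \<le> b" "r - \<bar>r - s\<bar> < of_rat a" "of_rat a < r" "r < of_rat b"
      "of_rat b < r + \<bar>r - s\<bar>"
    using ex_tight_ivl[of "\<bar>r - s\<bar>" r] by auto
  then show False
    using assms[of "ivl a b"] by (auto simp: real_ivl_ivl)
qed

section \<open>From real numbers to oracles\<close>

text \<open>A cut at \<open>c\<close> leaves \<open>r\<close> in exactly one half unless
  \<open>r\<close> equals \<open>c\<close>, which gives separation. For closedness, a rational lying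
  in every interval around \<open>r\<close> must be \<open>r\<close> itself.\<close>

lemma oracle_rule_real_ivl: "oracle_rule (\<lambda>A. r \<in> real_ivl A)"
proof -
  have "consistent_rule (\<lambda>A. r \<in> real_ivl A)"
    unfolding consistent_rule_def using real_ivl_mono by blast
  moreover have "existent_rule (\<lambda>A. r \<in> real_ivl A)"
  proof -
    obtain a b where "a \<le> b" "of_rat a < r" "r < of_rat b"
      by (rule ex_tight_ivl[of 1 r]) simp
    then have "r \<in> real_ivl (ivl a b)"
      by (simp add: real_ivl_ivl)
    then show ?thesis
      unfolding existent_rule_def by blast
  qed
  moreover have "separating_rule (\<lambda>A. r \<in> real_ivl A)"
    unfolding separating_rule_def
  proof (intro allI impI)
    fix a b c
    assume "r \<in> real_ivl (ivl a b)" "c \<in> points (ivl a b)" "c \<noteq> a" "c \<noteq> b"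
    then show "r \<in> real_ivl (ivl c c) \<or> (r \<in> real_ivl (ivl a c)) \<noteq> (r \<in> real_ivl (ivl c b))"
      by (cases a b rule: le_cases)
        (auto simp: real_ivl_def lower_ivl upper_ivl points_ivl min_absorb1 min_absorb2
          max_absorb1 max_absorb2)
  qed
  moreover have "rooted_rule (\<lambda>A. r \<in> real_ivl A)"
    by (auto simp: rooted_rule_def real_ivl_singleton)
  moreover have "closed_rule (\<lambda>A. r \<in> real_ivl A)"
    unfolding closed_rule_def
  proof (intro allI impI)
    fix c
    assume c: "\<forall>a b. r \<in> real_ivl (ivl a b) \<longrightarrow> c \<in> points (ivl a b)"
    have "of_rat c \<in> real_ivl A" if "r \<in> real_ivl A" for A
      using c that of_rat_mem_real_ivl_iff ivl_lower_upper by metis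
    then have "r = of_rat c"
      by (rule real_ivls_determine_point)
    then show "r \<in> real_ivl (ivl c c)"
      by (simp add: real_ivl_singleton)
  qed
  ultimately show ?thesis
    by (simp add: oracle_rule_def)
qed

definition real_oracle :: "real \<Rightarrow> rat_oracle" where
  "real_oracle r = Abs_rat_oracle (\<lambda>A. r \<in> real_ivl A)"

lemma yes_real_oracle: "yes (real_oracle r) A \<longleftrightarrow> r \<in> real_ivl A"
  by (simp add: real_oracle_def Abs_rat_oracle_inverse oracle_rule_real_ivl)

lemma inj_real_oracle: "inj real_oracle"
  by (rule injI) (metis real_ivls_determine_point yes_real_oracle)

section \<open>From oracles to real numbers\<close>

context
  fixes \<alpha> :: rat_oracle
begin

lemma yes_mono:
  assumes "yes \<alpha> A" "points A \<subseteq> points B"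
  shows "yes \<alpha> B"
proof -
  have "consistent_rule (yes \<alpha>)"
    using yes[of \<alpha>] by (simp add: oracle_rule_def)
  with assms show ?thesis
    unfolding consistent_rule_def by (metis ivl_lower_upper)
qed

lemma yes_widen:
  assumes "yes \<alpha> (ivl a b)" "a \<le> b" "a' \<le> a" "b \<le> b'"
  shows "yes \<alpha> (ivl a' b')"
  using assms by (intro yes_mono[OF assms(1)]) (auto simp: points_ivl)

lemma yes_split:
  assumes "yes \<alpha> (ivl a b)" "a < c" "c < b"
  shows "yes \<alpha> (ivl c c) \<or> yes \<alpha> (ivl a c) \<noteq> yes \<alpha> (ivl c b)"
proof -
  have "separating_rule (yes \<alpha>)"
    using yes[of \<alpha>] by (simp add: oracle_rule_def)
  with assms show ?thesis
    by (auto simp: separating_rule_def points_ivl)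
qed

lemma yes_rooted: "yes \<alpha> (ivl c c) \<Longrightarrow> yes \<alpha> (ivl d d) \<Longrightarrow> c = d"
  using yes[of \<alpha>] by (simp add: oracle_rule_def rooted_rule_def)

lemma yes_closed: "(\<And>A. yes \<alpha> A \<Longrightarrow> c \<in> points A) \<Longrightarrow> yes \<alpha> (ivl c c)"
  using yes[of \<alpha>] by (simp add: oracle_rule_def closed_rule_def)

lemma ex_yes: "\<exists>A. yes \<alpha> A"
  using yes[of \<alpha>] by (auto simp: oracle_rule_def existent_rule_def)

text \<open>Says that Yes intervals intersect. If \<open>ivl a b\<close> lay to the left of
  \<open>ivl c d\<close>, cutting \<open>ivl a d\<close> at \<open>b\<close> would give two Yes
  halves, so separation would make \<open>ivl b b\<close> a Yes interval. Cutting at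
  \<open>c\<close> does the same for \<open>ivl c c\<close>, and two Yes singletons contradict
  rootedness.\<close>

lemma yes_lower_le_upper:
  assumes "yes \<alpha> A" "yes \<alpha> B"
  shows "lower A \<le> upper B"
proof (cases A rule: ivl_cases; cases B rule: ivl_cases)
  fix c d a b
  assume cd: "c \<le> d" "A = ivl c d" and ab: "a \<le> b" "B = ivl a b"
  have "c \<le> b"
  proof (rule ccontr)
    assume "\<not> c \<le> b"
    then have "b < c"
      by simp
    have yes: "yes \<alpha> (ivl c d)" "yes \<alpha> (ivl a b)"
      using assms cd ab by auto
    have ad: "yes \<alpha> (ivl a d)"
      by (rule yes_widen[OF yes(1)]) (use cd ab \<open>b < c\<close> in auto)
    have "yes \<alpha> (ivl b b)"
    proof (cases "a = b")
      case False
      moreover have "yes \<alpha> (ivl b d)"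
        by (rule yes_widen[OF yes(1)]) (use cd \<open>b < c\<close> in auto)
      ultimately show ?thesis
        using yes_split[OF ad, of b] yes cd ab \<open>b < c\<close> by auto
    qed (use yes in auto)
    moreover have "yes \<alpha> (ivl c c)"
    proof (cases "c = d")
      case False
      moreover have "yes \<alpha> (ivl a c)"
        by (rule yes_widen[OF yes(2)]) (use ab \<open>b < c\<close> in auto)
      ultimately show ?thesis
        using yes_split[OF ad, of c] yes cd ab \<open>b < c\<close> by auto
    qed (use yes in auto)
    ultimately show False
      using yes_rooted \<open>b < c\<close> by blast
  qed
  then show ?thesis
    using cd ab by (simp add: lower_ivl upper_ivl)
qed

text \<open>Every lower endpoint is below every upper endpoint, so completeness of the reals
  supplies the supremum of the lower endpoints as a common point.\<close>

lemma ex_common_real: "\<exists>r. \<forall>A. yes \<alpha> A \<longrightarrow> r \<in> real_ivl A"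
proof -
  define L :: "real set" where "L = (\<lambda>A. of_rat (lower A)) ` Collect (yes \<alpha>)"
  have ub: "x \<le> of_rat (upper B)" if "x \<in> L" "yes \<alpha> B" for x B
    using that yes_lower_le_upper by (auto simp: L_def of_rat_less_eq)
  have "L \<noteq> {}"
    using ex_yes by (auto simp: L_def)
  moreover have "bdd_above L"
    using ex_yes ub by (auto simp: bdd_above_def)
  ultimately have "Sup L \<in> real_ivl A" if "yes \<alpha> A" for A
    using that ub by (auto simp: real_ivl_def L_def intro: cSup_upper cSup_least)
  then show ?thesis
    by blast
qed

text \<open>If \<open>r\<close> is an endpoint of \<open>A\<close>, it is rational and closedness
  yields a Yes singleton inside \<open>A\<close>. Otherwise a large Yes interval is cut down to
  \<open>A\<close> at both endpoints, and the parts that miss \<open>r\<close> are No.\<close>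

lemma yes_if_common_real:
  assumes common: "\<And>A. yes \<alpha> A \<Longrightarrow> r \<in> real_ivl A" and "r \<in> real_ivl A"
  shows "yes \<alpha> A"
proof -
  obtain a b where ab: "a \<le> b" "A = ivl a b"
    by (rule ivl_cases)
  show ?thesis
  proof (cases "r = of_rat a \<or> r = of_rat b")
    case True
    then obtain c where c: "c \<in> {a, b}" "r = of_rat c"
      by blast
    then have "yes \<alpha> (ivl c c)"
      using common of_rat_mem_real_ivl_iff by (intro yes_closed) blast
    then show ?thesis
      using c ab by (auto intro: yes_widen)
  next
    case False
    then have r: "of_rat a < r" "r < of_rat b"
      using assms(2) ab by (auto simp: real_ivl_ivl)
    then have "a < b"
      by (meson of_rat_less less_trans)
    obtain c d where cd: "c \<le> d" "yes \<alpha> (ivl c d)"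
      using ex_yes ivl_cases by metis
    \<comment> \<open>The minimum and maximum make the new interval contain \<open>ivl c d\<close>,
      so it is Yes. The shift by 1 puts \<open>a\<close> and \<open>b\<close> strictly inside it, as
      separation demands.\<close>
    define c' d' where "c' = min a c - 1" and "d' = max b d + 1"
    have bounds: "c' < a" "c' \<le> c" "b < d'" "d \<le> d'"
      by (auto simp: c'_def d'_def)
    have "yes \<alpha> (ivl c' d')"
      by (rule yes_widen[OF cd(2,1)]) (use bounds in auto)
    \<comment> \<open>None of these contains \<open>r\<close>, so each cut leaves only the other
      half as Yes.\<close>
    moreover have no: "\<not> yes \<alpha> (ivl a a)" "\<not> yes \<alpha> (ivl c' a)" "\<not> yes \<alpha> (ivl b b)"
        "\<not> yes \<alpha> (ivl b d')"
      using r bounds by (auto simp: real_ivl_ivl dest!: common)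
    ultimately have "yes \<alpha> (ivl a d')"
      using yes_split[of c' d' a] bounds \<open>a < b\<close> by auto
    then show ?thesis
      using yes_split[of a d' b] no bounds \<open>a < b\<close> ab by auto
  qed
qed

end

section \<open>The bijection between oracles and real numbers\<close>

lemma ex_real_oracle: "\<exists>r. \<alpha> = real_oracle r"
proof -
  obtain r where r: "\<And>A. yes \<alpha> A \<Longrightarrow> r \<in> real_ivl A"
    using ex_common_real by blast
  then have "yes \<alpha> = yes (real_oracle r)"
    using yes_if_common_real[of \<alpha> r] by (auto simp: yes_real_oracle)
  then show ?thesis
    by (auto simp: yes_inject)
qed

definition val :: "rat_oracle \<Rightarrow> real" where
  "val = inv real_oracle"

lemma val_real_oracle [simp]: "val (real_oracle r) = r"
  by (simp add: val_def inj_real_oracle)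

lemma real_oracle_val [simp]: "real_oracle (val \<alpha>) = \<alpha>"
  using ex_real_oracle[of \<alpha>] by auto

text \<open>As a rewrite rule this moves equations between oracles to the reals. It does not loop,
  because the right-hand side is an equation of another type.\<close>

lemma val_inject: "\<alpha> = \<beta> \<longleftrightarrow> val \<alpha> = val \<beta>"
  by (metis real_oracle_val)

lemma yes_iff: "yes \<alpha> A \<longleftrightarrow> val \<alpha> \<in> real_ivl A"
  by (metis real_oracle_val yes_real_oracle)

section \<open>Associated oracles and addition\<close>

text \<open>Evaluates the definite description for sums and products alike. The two assumptions
  yield both the fonsi property, which is part of the description, and uniqueness: the value of a
  competing oracle would lie in members of \<open>F\<close> arbitrarily close to
  \<open>r\<close>.\<close>

lemma associated_oracle_eqI:
  assumes mem: "\<And>A. A \<in> F \<Longrightarrow> r \<in> real_ivl A"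
    and small: "\<And>\<epsilon>. \<epsilon> > 0 \<Longrightarrow>
      \<exists>A\<in>F. r - \<epsilon> < of_rat (lower A) \<and> of_rat (upper A) < r + \<epsilon>"
  shows "associated_oracle F = real_oracle r"
  unfolding associated_oracle_def
proof (rule the_equality)
  have "points A \<inter> points B \<noteq> {}" if "A \<in> F" "B \<in> F" for A B
  proof -
    have "(of_rat (lower A) :: real) \<le> of_rat (upper B)"
        "(of_rat (lower B) :: real) \<le> of_rat (upper A)"
      using mem[OF that(1)] mem[OF that(2)] by (auto simp: real_ivl_def)
    \<comment> \<open>The common point must be rational, so \<open>r\<close> itself may not
      serve.\<close>
    then have "max (lower A) (lower B) \<in> points A \<inter> points B"
      \<comment> \<open>Only the occurrences under \<open>points\<close> are rewritten, so that
        \<open>points_ivl\<close> applies to them.\<close>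
      by (subst (3 4) ivl_lower_upper[symmetric])
        (simp add: points_ivl of_rat_less_eq lower_le_upper min_def max_def)
    then show ?thesis
      by blast
  qed
  moreover have "\<exists>A\<in>F. ivl_length A < q" if "q > 0" for q
  proof -
    have "(0 :: real) < of_rat q / 2"
      using that by simp
    then obtain A where A: "A \<in> F" "r - of_rat q / 2 < of_rat (lower A)"
        "of_rat (upper A) < r + of_rat q / 2"
      using small by blast
    then have "of_rat (upper A) - of_rat (lower A) < (of_rat q :: real)"
      by linarith
    then have "ivl_length A < q"
      unfolding ivl_length_def of_rat_diff[symmetric] of_rat_less .
    with A show ?thesis
      by blast
  qed
  ultimately show "fonsi F \<and> (\<forall>A\<in>F. yes (real_oracle r) A)"
    using mem by (simp add: fonsi_def yes_real_oracle)
next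
  fix \<gamma>
  assume "fonsi F \<and> (\<forall>A\<in>F. yes \<gamma> A)"
  then have \<gamma>: "val \<gamma> \<in> real_ivl A" if "A \<in> F" for A
    using that by (simp add: yes_iff)
  have "val \<gamma> = r"
  proof (rule ccontr)
    assume "val \<gamma> \<noteq> r"
    then have "0 < \<bar>val \<gamma> - r\<bar>"
      by simp
    then obtain A where "A \<in> F" "r - \<bar>val \<gamma> - r\<bar> < of_rat (lower A)"
        "of_rat (upper A) < r + \<bar>val \<gamma> - r\<bar>"
      using small by blast
    then show False
      using \<gamma>[of A] by (auto simp: real_ivl_def)
  qed
  then show "\<gamma> = real_oracle r"
    by auto
qed

lemma real_ivl_add:
  assumes "r \<in> real_ivl A" "s \<in> real_ivl B"
  shows "r + s \<in> real_ivl (A \<oplus> B)"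
  using assms lower_le_upper[of A] lower_le_upper[of B]
  by (simp add: ivl_add_def real_ivl_ivl add_mono of_rat_add) (simp add: real_ivl_def add_mono)

lemma val_add: "val (\<alpha> + \<beta>) = val \<alpha> + val \<beta>"
proof -
  have "\<alpha> + \<beta> = real_oracle (val \<alpha> + val \<beta>)"
    unfolding plus_rat_oracle_def
  proof (rule associated_oracle_eqI)
    fix \<epsilon> :: real
    assume "\<epsilon> > 0"
    then have \<epsilon>: "\<epsilon> / 2 > 0"
      by simp
    obtain a b where ab: "a \<le> b" "val \<alpha> - \<epsilon> / 2 < of_rat a" "of_rat a < val \<alpha>"
        "val \<alpha> < of_rat b" "of_rat b < val \<alpha> + \<epsilon> / 2"
      by (rule ex_tight_ivl[OF \<epsilon>])
    obtain c d where cd: "c \<le> d" "val \<beta> - \<epsilon> / 2 < of_rat c" "of_rat c < val \<beta>"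
        "val \<beta> < of_rat d" "of_rat d < val \<beta> + \<epsilon> / 2"
      by (rule ex_tight_ivl[OF \<epsilon>])
    have "yes \<alpha> (ivl a b)" "yes \<beta> (ivl c d)"
      using ab cd by (simp_all add: yes_iff real_ivl_ivl)
    moreover have "val \<alpha> + val \<beta> - \<epsilon> < of_rat (lower (ivl a b \<oplus> ivl c d))"
      "of_rat (upper (ivl a b \<oplus> ivl c d)) < val \<alpha> + val \<beta> + \<epsilon>"
      using ab cd by (simp_all add: ivl_add_def lower_ivl upper_ivl add_mono of_rat_add)
    ultimately show "\<exists>A\<in>{A \<oplus> B |A B. yes \<alpha> A \<and> yes \<beta> B}.
        val \<alpha> + val \<beta> - \<epsilon> < of_rat (lower A) \<and> of_rat (upper A) < val \<alpha> + val \<beta> + \<epsilon>"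
      by blast
  qed (auto simp: yes_iff real_ivl_add)
  then show ?thesis
    by simp
qed

section \<open>Multiplication\<close>

text \<open>The product is linear in each factor. So \<open>r\<close> moves to an endpoint in the
  direction given by the sign of \<open>s\<close>, and then \<open>s\<close> moves likewise by the
  sign of the endpoint chosen.\<close>

lemma ex_corner_product_le:
  fixes r s :: "'a::linordered_idom"
  assumes "a \<le> r" "r \<le> b" "c \<le> s" "s \<le> d"
  shows "\<exists>x\<in>{a, b}. \<exists>y\<in>{c, d}. x * y \<le> r * s"
proof -
  obtain x where x: "x \<in> {a, b}" "x * s \<le> r * s"
    using assms by (cases "0 \<le> s") (auto intro: mult_right_mono mult_right_mono_neg)
  obtain y where y: "y \<in> {c, d}" "x * y \<le> x * s"
    using assms by (cases "0 \<le> x") (auto intro: mult_left_mono mult_left_mono_neg)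
  show ?thesis
    using x y order_trans by blast
qed

lemma ex_corner_product_ge:
  fixes r s :: "'a::linordered_idom"
  assumes "a \<le> r" "r \<le> b" "c \<le> s" "s \<le> d"
  shows "\<exists>x\<in>{a, b}. \<exists>y\<in>{c, d}. r * s \<le> x * y"
  \<comment> \<open>Negating the first factor reverses the inequality and swaps the roles of
    \<open>a\<close> and \<open>b\<close>.\<close>
  using ex_corner_product_le[of "- b" "- r" "- a" c s d] assms by auto

text \<open>The set \<open>P\<close> from the definition of \<open>\<otimes>\<close>, in a form from
  which the two factors of an element can be recovered.\<close>

definition corners :: "rat_interval \<Rightarrow> rat_interval \<Rightarrow> rat set" where
  "corners A B = {x * y |x y. x \<in> {lower A, upper A} \<and> y \<in> {lower B, upper B}}"

lemma corners_eq: "corners A B =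
    {lower A * lower B, lower A * upper B, upper A * lower B, upper A * upper B}"
  by (auto simp: corners_def)

lemma finite_corners: "finite (corners A B)" and corners_nonempty: "corners A B \<noteq> {}"
  by (simp_all add: corners_eq)

lemma lower_mult: "lower (A \<otimes> B) = Min (corners A B)"
  and upper_mult: "upper (A \<otimes> B) = Max (corners A B)"
proof -
  have "Min (corners A B) \<le> Max (corners A B)"
    using finite_corners corners_nonempty by simp
  then show "lower (A \<otimes> B) = Min (corners A B)" "upper (A \<otimes> B) = Max (corners A B)"
    by (simp_all only: ivl_mult_def Let_def corners_eq[symmetric] lower_ivl upper_ivl
        min_absorb1 max_absorb2)
qed

lemma real_ivl_mult:
  assumes "r \<in> real_ivl A" "s \<in> real_ivl B"
  shows "r * s \<in> real_ivl (A \<otimes> B)"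
proof -
  have bounds: "of_rat (lower A) \<le> r" "r \<le> of_rat (upper A)" "of_rat (lower B) \<le> s"
      "s \<le> of_rat (upper B)"
    using assms by (auto simp: real_ivl_def)
  have "\<exists>z\<in>corners A B. of_rat z \<le> r * s"
    using ex_corner_product_le[OF bounds] by (auto simp: corners_eq of_rat_mult)
  then obtain z where z: "z \<in> corners A B" "of_rat z \<le> r * s"
    by blast
  have "\<exists>w\<in>corners A B. r * s \<le> of_rat w"
    using ex_corner_product_ge[OF bounds] by (auto simp: corners_eq of_rat_mult)
  then obtain w where w: "w \<in> corners A B" "r * s \<le> of_rat w"
    by blast
  have "(of_rat (Min (corners A B)) :: real) \<le> of_rat z"
      "(of_rat w :: real) \<le> of_rat (Max (corners A B))"
    using z w finite_corners by (simp_all add: of_rat_less_eq)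
  with z w show ?thesis
    by (simp add: real_ivl_def lower_mult upper_mult)
qed

text \<open>Expanding around \<open>r\<close> and \<open>s\<close> leaves one quadratic term, which
  \<delta> \<le> 1 bounds by a linear one.\<close>

lemma mult_close:
  fixes r s \<delta> :: real
  assumes "\<bar>x - r\<bar> < \<delta>" "\<bar>y - s\<bar> < \<delta>" "\<delta> \<le> 1"
  shows "\<bar>x * y - r * s\<bar> < \<delta> * (1 + \<bar>r\<bar> + \<bar>s\<bar>)"
proof -
  have "\<delta> > 0"
    using assms by linarith
  have "x * y - r * s = (x - r) * (y - s) + r * (y - s) + (x - r) * s"
    by (simp add: algebra_simps)
  also have "\<bar>\<dots>\<bar> \<le> \<bar>x - r\<bar> * \<bar>y - s\<bar> + \<bar>r\<bar> * \<bar>y - s\<bar> + \<bar>x - r\<bar> * \<bar>s\<bar>"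
    unfolding abs_mult[symmetric] by linarith
  also have "\<dots> < \<delta> * 1 + \<bar>r\<bar> * \<delta> + \<delta> * \<bar>s\<bar>"
    using assms \<open>\<delta> > 0\<close>
    by (intro add_less_le_mono mult_strict_mono mult_left_mono mult_right_mono) auto
  finally show ?thesis
    by (simp add: algebra_simps)
qed

lemma val_mult: "val (\<alpha> * \<beta>) = val \<alpha> * val \<beta>"
proof -
  have "\<alpha> * \<beta> = real_oracle (val \<alpha> * val \<beta>)"
    unfolding times_rat_oracle_def
  proof (rule associated_oracle_eqI)
    fix \<epsilon> :: real
    assume "\<epsilon> > 0"
    define K where "K = 1 + \<bar>val \<alpha>\<bar> + \<bar>val \<beta>\<bar>"
    \<comment> \<open>The two arguments of \<open>min\<close> give the bounds \<delta> \<le> 1 for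
      \<open>mult_close\<close> and \<open>\<delta> * K \<le> \<epsilon>\<close> for the final
      estimate.\<close>
    define \<delta> where "\<delta> = min 1 (\<epsilon> / K)"
    have "K > 0"
      by (simp add: K_def add_pos_nonneg)
    then have \<delta>: "\<delta> > 0" "\<delta> \<le> 1" "\<delta> * K \<le> \<epsilon>"
      using \<open>\<epsilon> > 0\<close> by (simp_all add: \<delta>_def field_simps min_def)
    obtain a b where ab: "a \<le> b" "val \<alpha> - \<delta> < of_rat a" "of_rat a < val \<alpha>"
        "val \<alpha> < of_rat b" "of_rat b < val \<alpha> + \<delta>"
      by (rule ex_tight_ivl[OF \<delta>(1)])
    obtain c d where cd: "c \<le> d" "val \<beta> - \<delta> < of_rat c" "of_rat c < val \<beta>"
        "val \<beta> < of_rat d" "of_rat d < val \<beta> + \<delta>"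
      by (rule ex_tight_ivl[OF \<delta>(1)])
    let ?A = "ivl a b" and ?B = "ivl c d"
    have close: "\<bar>of_rat z - val \<alpha> * val \<beta>\<bar> < \<epsilon>" if z_corner: "z \<in> corners ?A ?B" for z
    proof -
      obtain x y where z: "z = x * y" and xy: "x \<in> {a, b}" "y \<in> {c, d}"
        using z_corner ab cd by (auto simp: corners_def lower_ivl upper_ivl)
      have "\<bar>of_rat x - val \<alpha>\<bar> < \<delta>" "\<bar>of_rat y - val \<beta>\<bar> < \<delta>"
        using xy ab cd by auto
      then show ?thesis
        using mult_close[of "of_rat x" "val \<alpha>" \<delta> "of_rat y" "val \<beta>"] \<delta>
        by (simp add: z of_rat_mult K_def)
    qed
    have "\<bar>of_rat (lower (?A \<otimes> ?B)) - val \<alpha> * val \<beta>\<bar> < \<epsilon>"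
      "\<bar>of_rat (upper (?A \<otimes> ?B)) - val \<alpha> * val \<beta>\<bar> < \<epsilon>"
      unfolding lower_mult upper_mult
      by (intro close Min_in Max_in finite_corners corners_nonempty)+
    then have "val \<alpha> * val \<beta> - \<epsilon> < of_rat (lower (?A \<otimes> ?B))"
      "of_rat (upper (?A \<otimes> ?B)) < val \<alpha> * val \<beta> + \<epsilon>"
      by linarith+
    moreover have "yes \<alpha> ?A" "yes \<beta> ?B"
      using ab cd by (simp_all add: yes_iff real_ivl_ivl)
    ultimately show "\<exists>A\<in>{A \<otimes> B |A B. yes \<alpha> A \<and> yes \<beta> B}.
        val \<alpha> * val \<beta> - \<epsilon> < of_rat (lower A) \<and> of_rat (upper A) < val \<alpha> * val \<beta> + \<epsilon>"
      by blast
  qed (auto simp: yes_iff real_ivl_mult)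
  then show ?thesis
    by simp
qed

section \<open>Constants, order and the derived operations\<close>

lemma val_oracle_of_rat: "val (oracle_of_rat q) = of_rat q"
proof -
  have "oracle_of_rat q = real_oracle (of_rat q)"
    by (simp add: oracle_of_rat_def real_oracle_def of_rat_mem_real_ivl_iff)
  then show ?thesis
    by simp
qed

lemma val_zero: "val 0 = 0" and val_one: "val 1 = 1"
  by (simp_all add: zero_rat_oracle_def one_rat_oracle_def val_oracle_of_rat)

lemma val_less: "\<alpha> < \<beta> \<longleftrightarrow> val \<alpha> < val \<beta>"
proof
  assume "\<alpha> < \<beta>"
  then obtain a b c d where yes: "yes \<alpha> (ivl a b)" "yes \<beta> (ivl c d)"
    and less: "a < c" "a < d" "b < c" "b < d"
    by (auto simp: less_rat_oracle_def)
  have "val \<alpha> \<le> of_rat (max a b)" "of_rat (min c d) \<le> val \<beta>"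
    using yes by (simp_all add: yes_iff real_ivl_def lower_ivl upper_ivl)
  moreover have "(of_rat (max a b) :: real) < of_rat (min c d)"
    using less by (simp add: of_rat_less)
  ultimately show "val \<alpha> < val \<beta>"
    by linarith
next
  assume "val \<alpha> < val \<beta>"
  \<comment> \<open>With half the gap as radius, the two intervals stay on opposite sides of the
    midpoint.\<close>
  then have \<epsilon>: "(val \<beta> - val \<alpha>) / 2 > 0"
    by simp
  obtain a b where ab: "a \<le> b" "of_rat a < val \<alpha>" "val \<alpha> < of_rat b"
      "of_rat b < val \<alpha> + (val \<beta> - val \<alpha>) / 2"
    by (rule ex_tight_ivl[OF \<epsilon>])
  obtain c d where cd: "c \<le> d" "val \<beta> - (val \<beta> - val \<alpha>) / 2 < of_rat c" "of_rat c < val \<beta>"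
      "val \<beta> < of_rat d"
    by (rule ex_tight_ivl[OF \<epsilon>])
  have "(of_rat b :: real) < of_rat c"
    using ab cd by argo
  then have "b < c"
    by (simp add: of_rat_less)
  moreover have "yes \<alpha> (ivl a b)" "yes \<beta> (ivl c d)"
    using ab cd by (simp_all add: yes_iff real_ivl_ivl)
  ultimately show "\<alpha> < \<beta>"
    unfolding less_rat_oracle_def using ab(1) cd(1) by (meson le_less_trans less_le_trans)
qed

lemma val_le: "\<alpha> \<le> \<beta> \<longleftrightarrow> val \<alpha> \<le> val \<beta>"
  by (auto simp: less_eq_rat_oracle_def val_less val_inject)

text \<open>Through \<open>val_inject\<close> the defining equation becomes a real one, whose unique
  solution determines the description.\<close>

lemma val_uminus: "val (- \<alpha>) = - val \<alpha>"
proof -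
  have "- \<alpha> = real_oracle (- val \<alpha>)"
    unfolding uminus_rat_oracle_def
    by (rule the_equality) (auto simp: val_inject val_add val_zero)
  then show ?thesis
    by simp
qed

text \<open>Holds at zero as well, since the reals follow the same convention for
  \<open>inverse 0\<close>.\<close>

lemma val_inverse: "val (inverse \<alpha>) = inverse (val \<alpha>)"
proof (cases "\<alpha> = 0")
  case False
  then have "val \<alpha> \<noteq> 0"
    by (simp add: val_inject val_zero)
  then have "(THE \<beta>. \<alpha> * \<beta> = 1) = real_oracle (inverse (val \<alpha>))"
    by (intro the_equality) (auto simp: val_inject val_mult val_one field_simps)
  with False show ?thesis
    by (simp add: inverse_rat_oracle_def)
qed (simp add: inverse_rat_oracle_def val_zero)

lemma val_minus: "val (\<alpha> - \<beta>) = val \<alpha> - val \<beta>"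
  by (simp add: minus_rat_oracle_def val_add val_uminus)

lemma val_divide: "val (\<alpha> div \<beta>) = val \<alpha> / val \<beta>"
  by (simp add: divide_rat_oracle_def val_mult val_inverse divide_inverse)

text \<open>These rules translate each class axiom into the corresponding fact about real
  numbers.\<close>

lemmas val_simps = val_inject val_zero val_one val_add val_mult val_uminus val_minus val_inverse
  val_divide val_less val_le

theorem theorem5p8:
  shows "OFCLASS(rat_oracle, linordered_field_class)"
  by intro_classes
    (auto simp: val_simps abs_rat_oracle_def sgn_rat_oracle_def algebra_simps divide_inverse
      mult_strict_left_mono)

end
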